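(* Let $A$ be a subring of a field $K$. Then $R=A+XK[X]$ is an HFD if and only if $A$ is a field.
   Context: All rings are commutative with unity. $A+XK[X]$ denotes the subring of the polynomial ring $K[X]$ consisting of the polynomials whose constant term lies in $A$. An integral domain is atomic if every nonzero noninvertible element is a product of irreducible elements. An integral domain is a half-factorial domain (HFD) if it is atomic and, for each nonzero nonunit, all factorizations of that element into products of irreducible elements have the same length. *)

theory Defs
  imports "HOL-Algebra.Polynomial_Divisibility"
begin

(* The library predicate "factors" is applied to R itself: since a is nonzero, no zero element
   can occur in a list fs whose product is a, so it does not matter that the divisibility
   relation of R also covers zero. The library predicate does not require fs to lie in the
   carrier, so this is demanded separately. *)
locale atomic_domain = "domain" +
  assumes factorization_exists:
    "\<lbrakk> a \<in> carrier R; a \<noteq> \<zero>; a \<notin> Units R \<rbrakk> \<Longrightarrow> \<exists>fs. set fs \<subseteq> carrier R \<and> factors R fs a"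

locale half_factorial_domain = atomic_domain +
  assumes factorization_length_unique:
    "\<lbrakk> a \<in> carrier R; a \<noteq> \<zero>; a \<notin> Units R;
       set fs \<subseteq> carrier R; factors R fs a; set gs \<subseteq> carrier R; factors R gs a \<rbrakk>
     \<Longrightarrow> length fs = length gs"

definition A_plus_XKX :: "'a set \<Rightarrow> ('a, 'b) ring_scheme \<Rightarrow> 'a list ring"
  where "A_plus_XKX A K =
    (univ_poly K (carrier K))
      \<lparr> carrier := { p \<in> carrier (univ_poly K (carrier K)). ring.const_term K p \<in> A } \<rparr>"

end

theory Submission
  imports Defs
begin

text \<open>If \<open>A\<close> is a field, every factorization in \<open>K[X]\<close> of an element of \<open>A + XK[X]\<close> can be rescaled
  by a constant so that both factors lie in \<open>A + XK[X]\<close>. Irreducibles of \<open>A + XK[X]\<close> are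
  therefore irreducible in \<open>K[X]\<close>, and the length of a factorization is the one prescribed by
  unique factorization in \<open>K[X]\<close>. Conversely, atomicity alone already forces \<open>A\<close> to be a field,
  by looking at an irreducible factor of \<open>X\<close> that vanishes at \<open>0\<close>.\<close>

section \<open>The ring structure and units of \<open>A_plus_XKX A R\<close>\<close>

lemma carrier_A_plus_XKX:
  "p \<in> carrier (A_plus_XKX A K) \<longleftrightarrow> p \<in> carrier (poly_ring K) \<and> ring.const_term K p \<in> A"
  by (simp add: A_plus_XKX_def)

lemma A_plus_XKX_ops [simp]:
  "mult (A_plus_XKX A K) = mult (poly_ring K)"
  "one (A_plus_XKX A K) = one (poly_ring K)"
  "zero (A_plus_XKX A K) = zero (poly_ring K)"
  by (simp_all add: A_plus_XKX_def)

context field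
begin

text \<open>In this context \<open>R\<close> is the field K. Taking the constant term is a ring
  homomorphism from K[X] to K, so the preimage of the subring \<open>A\<close> is a subring of the
  domain K[X].\<close>

lemma domain_A_plus_XKX:
  assumes "subring A R"
  shows "domain (A_plus_XKX A R)"
proof -
  interpret UP: domain "poly_ring R"
    using univ_poly_is_domain[OF carrier_is_subring] .
  note const_term = const_term_simprules_shell[OF carrier_is_subring]
  have "const_term \<one>\<^bsub>poly_ring R\<^esub> = \<one>"
    by (simp add: univ_poly_one const_term_def)
  then have "subring {p \<in> carrier (poly_ring R). const_term p \<in> A} (poly_ring R)"
    using subringE[OF assms] const_term by (intro UP.subringI) auto
  from UP.subring_is_domain[OF this] show ?thesis
    by (simp add: A_plus_XKX_def)
qed

lemma Units_A_plus_XKX_subset: "Units (A_plus_XKX A R) \<subseteq> Units (poly_ring R)"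
  unfolding Units_def by (auto simp: carrier_A_plus_XKX)

lemma const_poly:
  assumes "a \<in> carrier R" "a \<noteq> \<zero>"
  shows "[a] \<in> carrier (poly_ring R)" "const_term [a] = a"
  using assms by (auto simp: const_term_def univ_poly_carrier[symmetric])

lemma mult_const_poly_inv:
  assumes "a \<in> carrier R" "a \<noteq> \<zero>"
  shows "[a] \<otimes>\<^bsub>poly_ring R\<^esub> [inv a] = \<one>\<^bsub>poly_ring R\<^esub>"
  using assms field_Units poly_mult_const(1)[OF carrier_is_subring, of "[inv a]" a]
  by (auto simp: univ_poly_mult univ_poly_one univ_poly_carrier const_poly)

lemma const_term_Units:
  assumes "p \<in> Units (poly_ring R)"
  shows "const_term p \<noteq> \<zero>"
proof -
  obtain a where "p = [a]" "a \<in> carrier R" "a \<noteq> \<zero>"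
    using assms unfolding univ_poly_units[OF carrier_is_subfield] by blast
  then show ?thesis
    by (simp add: const_poly)
qed

text \<open>Units of K[X] are nonzero constants \<open>[a]\<close>; if \<open>a\<close> lies in the
  subfield \<open>A\<close>, so does \<open>inv a\<close>. For a mere subring this fails: 2 is not a
  unit of Z + XQ[X].\<close>

lemma Units_A_plus_XKX:
  assumes "subfield A R"
  shows "Units (A_plus_XKX A R) = carrier (A_plus_XKX A R) \<inter> Units (poly_ring R)"
proof (intro equalityI subsetI)
  fix p assume "p \<in> carrier (A_plus_XKX A R) \<inter> Units (poly_ring R)"
  then have "p \<in> Units (poly_ring R)" and A: "const_term p \<in> A"
    by (auto simp: carrier_A_plus_XKX)
  then obtain a where a: "p = [a]" "a \<in> carrier R" "a \<noteq> \<zero>"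
    unfolding univ_poly_units[OF carrier_is_subfield] by blast
  then have "a \<in> A"
    using A const_poly by simp
  with a have inv: "inv a \<in> A" "inv a \<in> carrier R" "inv a \<noteq> \<zero>"
    using subfield_m_inv[OF assms, of a] subfieldE(3)[OF assms] by auto
  then have "[inv a] \<otimes>\<^bsub>poly_ring R\<^esub> [a] = \<one>\<^bsub>poly_ring R\<^esub>"
    using mult_const_poly_inv[of "inv a"] a field_Units by simp
  then show "p \<in> Units (A_plus_XKX A R)"
    unfolding Units_def using a inv \<open>a \<in> A\<close> mult_const_poly_inv[of a]
    by (auto simp: carrier_A_plus_XKX const_poly)
next
  fix p assume "p \<in> Units (A_plus_XKX A R)"
  then show "p \<in> carrier (A_plus_XKX A R) \<inter> Units (poly_ring R)"
    using Units_A_plus_XKX_subset unfolding Units_def by blast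
qed

section \<open>Irreducibility passes to K[X]\<close>

text \<open>Membership depends only on constant terms, so it suffices to move g(0) and h(0) into
  \<open>A\<close> by a nonzero scalar and its inverse, knowing that g(0)h(0) lies in
  \<open>A\<close>.\<close>

lemma rescaled_factors:
  assumes "subring A R" "g \<in> carrier (poly_ring R)" "h \<in> carrier (poly_ring R)"
    and gh: "g \<otimes>\<^bsub>poly_ring R\<^esub> h \<in> carrier (A_plus_XKX A R)"
  obtains c where "c \<in> carrier R" "c \<noteq> \<zero>"
    "[c] \<otimes>\<^bsub>poly_ring R\<^esub> g \<in> carrier (A_plus_XKX A R)"
    "[inv c] \<otimes>\<^bsub>poly_ring R\<^esub> h \<in> carrier (A_plus_XKX A R)"
proof -
  interpret UP: domain "poly_ring R"
    using univ_poly_is_domain[OF carrier_is_subring] .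
  note const_term = const_term_simprules_shell[OF carrier_is_subring]
  let ?g = "const_term g" and ?h = "const_term h"
  have carr: "?g \<in> carrier R" "?h \<in> carrier R"
    using assms const_term(1) by auto
  have A: "\<zero> \<in> A" "\<one> \<in> A"
    using subringE[OF assms(1)] by auto
  have prod: "?g \<otimes> ?h \<in> A"
    using gh assms const_term(2) by (simp add: carrier_A_plus_XKX)
  \<comment> \<open>If g(0) is nonzero, c = 1/g(0) turns the two constant terms into 1 and g(0)h(0).
    If g(0) = 0, c = h(0) gives 0 and 1, and c = 1 serves when h(0) = 0 as well.\<close>
  have "\<exists>c \<in> carrier R - {\<zero>}. c \<otimes> ?g \<in> A \<and> inv c \<otimes> ?h \<in> A"
  proof (cases "?g = \<zero>")
    case False
    then show ?thesis
      using carr A prod field_Units by (intro bexI[of _ "inv ?g"]) auto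
  next
    case True
    then show ?thesis
      using carr A field_Units
      by (cases "?h = \<zero>") (auto intro: bexI[of _ "\<one>"] bexI[of _ ?h])
  qed
  then obtain c where c: "c \<in> carrier R" "c \<noteq> \<zero>" "c \<otimes> ?g \<in> A" "inv c \<otimes> ?h \<in> A"
    by auto
  moreover have "inv c \<in> carrier R" "inv c \<noteq> \<zero>"
    using c field_Units by auto
  ultimately show thesis
    using assms const_term(2) const_poly
    by (intro that[of c]) (auto simp: carrier_A_plus_XKX)
qed

text \<open>A factorization in K[X] rescales to one in \<open>A_plus_XKX A R\<close>, where one
  factor must be a unit. The last assumption excludes irreducible constants, such as 2 in Z +
  XQ[X].\<close>

lemma irreducible_A_plus_XKX_imp_pirreducible:
  assumes "subring A R" "f \<in> carrier (A_plus_XKX A R)"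
    and irr: "ring_irreducible\<^bsub>A_plus_XKX A R\<^esub> f" and "f \<notin> Units (poly_ring R)"
  shows "pirreducible (carrier R) f"
proof (rule pirreducibleI[OF carrier_is_subring])
  interpret UP: domain "poly_ring R"
    using univ_poly_is_domain[OF carrier_is_subring] .
  interpret S: domain "A_plus_XKX A R"
    using domain_A_plus_XKX[OF assms(1)] .
  show "f \<in> carrier (poly_ring R)" "f \<notin> Units (poly_ring R)"
    using assms by (auto simp: carrier_A_plus_XKX)
  show "f \<noteq> []"
    using S.ring_irreducibleE(1)[OF assms(2) irr] by (simp add: univ_poly_zero)
  fix g h
  assume gh: "g \<in> carrier (poly_ring R)" "h \<in> carrier (poly_ring R)" "f = g \<otimes>\<^bsub>poly_ring R\<^esub> h"
  then obtain c where c: "c \<in> carrier R" "c \<noteq> \<zero>"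
    "[c] \<otimes>\<^bsub>poly_ring R\<^esub> g \<in> carrier (A_plus_XKX A R)"
    "[inv c] \<otimes>\<^bsub>poly_ring R\<^esub> h \<in> carrier (A_plus_XKX A R)"
    using rescaled_factors[OF assms(1)] assms(2) by metis
  then have c': "inv c \<in> carrier R" "inv c \<noteq> \<zero>"
    using field_Units by auto
  note closed = const_poly(1)[OF c(1,2)] const_poly(1)[OF c']
  have "([c] \<otimes>\<^bsub>poly_ring R\<^esub> g) \<otimes>\<^bsub>poly_ring R\<^esub> ([inv c] \<otimes>\<^bsub>poly_ring R\<^esub> h)
      = ([c] \<otimes>\<^bsub>poly_ring R\<^esub> [inv c]) \<otimes>\<^bsub>poly_ring R\<^esub> (g \<otimes>\<^bsub>poly_ring R\<^esub> h)"
    using gh(1,2) closed by (simp add: UP.m_ac)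
  also have "\<dots> = f"
    using gh by (simp add: mult_const_poly_inv[OF c(1,2)])
  finally have "[c] \<otimes>\<^bsub>poly_ring R\<^esub> g \<in> Units (poly_ring R) \<or>
      [inv c] \<otimes>\<^bsub>poly_ring R\<^esub> h \<in> Units (poly_ring R)"
    using S.ring_irreducibleE(5)[OF assms(2) irr c(3,4)] Units_A_plus_XKX_subset by auto
  then show "g \<in> Units (poly_ring R) \<or> h \<in> Units (poly_ring R)"
    using gh closed UP.m_comm UP.unit_factor by metis
qed

section \<open>Half-factoriality when \<open>A\<close> is a field\<close>

text \<open>Induction on the degree: both factors of a proper factorization have positive degree,
  hence smaller degree than \<open>f\<close>.\<close>

lemma A_plus_XKX_factorization_exists:
  assumes A: "subfield A R"
    and "f \<in> carrier (A_plus_XKX A R)" "f \<noteq> \<zero>\<^bsub>A_plus_XKX A R\<^esub>" "f \<notin> Units (A_plus_XKX A R)"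
  shows "\<exists>fs. set fs \<subseteq> carrier (A_plus_XKX A R) \<and> factors (A_plus_XKX A R) fs f"
  using assms(2-)
proof (induction "degree f" arbitrary: f rule: less_induct)
  case less
  let ?S = "A_plus_XKX A R"
  interpret S: domain ?S
    using domain_A_plus_XKX[OF subfieldE(1)[OF A]] .
  show ?case
  proof (cases "ring_irreducible\<^bsub>?S\<^esub> f")
    case True
    then have "factors ?S [f] f"
      using less.prems by (auto simp: factors_def ring_irreducible_def simp del: A_plus_XKX_ops)
    then show ?thesis
      using less.prems by (intro exI[of _ "[f]"]) auto
  next
    case False
    then obtain g h where gh: "g \<in> carrier ?S" "h \<in> carrier ?S" "f = g \<otimes>\<^bsub>?S\<^esub> h"
      "g \<notin> Units ?S" "h \<notin> Units ?S"
      using S.ring_irreducibleI[of f] less.prems by auto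
    have nz: "g \<noteq> \<zero>\<^bsub>?S\<^esub>" "h \<noteq> \<zero>\<^bsub>?S\<^esub>"
      using gh less.prems(2) S.l_null S.r_null by auto
    have poly: "g \<in> carrier (poly_ring R)" "h \<in> carrier (poly_ring R)" "g \<noteq> []" "h \<noteq> []"
      using gh nz by (auto simp: carrier_A_plus_XKX univ_poly_zero)
    \<comment> \<open>A nonzero constant is a unit of K[X], hence of the subring because
      \<open>A\<close> is a field.\<close>
    have "degree g \<noteq> 0" "degree h \<noteq> 0"
      using gh poly Units_A_plus_XKX[OF A] univ_poly_units'[OF carrier_is_subfield] by auto
    moreover have "degree f = degree g + degree h"
      using gh(3) poly poly_mult_degree_eq[OF carrier_is_subring, of g h]
      by (simp add: univ_poly_mult univ_poly_carrier)
    ultimately have "degree g < degree f" "degree h < degree f"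
      by auto
    then obtain gs hs where "set gs \<subseteq> carrier ?S" "factors ?S gs g"
      "set hs \<subseteq> carrier ?S" "factors ?S hs h"
      using less.hyps gh nz by metis
    then show ?thesis
      using S.factors_mult[of gs g hs h] gh(3) by (intro exI[of _ "gs @ hs"]) auto
  qed
qed

text \<open>The right-hand side does not mention \<open>fs\<close>, so all factorizations of
  \<open>a\<close> have equal length. Its \<open>mult_of\<close> removes zero, giving the monoid in
  which unique factorization is stated.\<close>

lemma A_plus_XKX_factors_length:
  assumes A: "subfield A R"
    and a: "a \<in> carrier (A_plus_XKX A R)" "a \<noteq> \<zero>\<^bsub>A_plus_XKX A R\<^esub>"
    and fs: "set fs \<subseteq> carrier (A_plus_XKX A R)" "factors (A_plus_XKX A R) fs a"
  shows "length fs = factorcount (mult_of (poly_ring R)) a"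
proof -
  let ?S = "A_plus_XKX A R"
  interpret UP: principal_domain "poly_ring R"
    using univ_poly_is_principal[OF carrier_is_subfield] .
  interpret S: domain ?S
    using domain_A_plus_XKX[OF subfieldE(1)[OF A]] .
  have prod: "foldr (\<otimes>\<^bsub>poly_ring R\<^esub>) fs \<one>\<^bsub>poly_ring R\<^esub> = a"
    using fs(2) by (simp add: factors_def)
  have carr: "set fs \<subseteq> carrier (poly_ring R)"
    using fs(1) by (auto simp: carrier_A_plus_XKX)
  \<comment> \<open>Every entry of \<open>fs\<close> divides the nonzero \<open>a\<close>, so none
    is zero and irreducibility becomes \<open>ring_irreducible\<close>.\<close>
  have "f divides\<^bsub>poly_ring R\<^esub> a" if "f \<in> set fs" for f
    using UP.multlist_dividesI[OF that carr] by (simp add: prod)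
  then have nz: "\<zero>\<^bsub>poly_ring R\<^esub> \<notin> set fs"
    using a(2) UP.zero_divides by auto
  have "irreducible (mult_of (poly_ring R)) f" if "f \<in> set fs" for f
  proof -
    have f: "f \<in> carrier ?S" "ring_irreducible\<^bsub>?S\<^esub> f"
      using that fs nz by (auto simp: factors_def ring_irreducible_def)
    then have "f \<notin> Units (poly_ring R)"
      using Units_A_plus_XKX[OF A] by (auto simp: ring_irreducible_def irreducible_def)
    with f have "pirreducible (carrier R) f"
      using irreducible_A_plus_XKX_imp_pirreducible[OF subfieldE(1)[OF A]] by blast
    then show ?thesis
      using UP.ring_irreducibleE(3) carr that by blast
  qed
  then have "factors (mult_of (poly_ring R)) fs a"
    using prod by (simp add: factors_def)
  moreover have "set fs \<subseteq> carrier (mult_of (poly_ring R))"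
    using carr nz by auto
  moreover have "a \<in> carrier (mult_of (poly_ring R))"
    using a by (simp add: carrier_A_plus_XKX)
  ultimately show ?thesis
    using UP.mult_of.factorcount_unique[of fs a] UP.mult_of.factors_wfactors[of fs a] by simp
qed

lemma subfield_imp_half_factorial_A_plus_XKX:
  assumes "subfield A R"
  shows "half_factorial_domain (A_plus_XKX A R)"
proof -
  interpret S: domain "A_plus_XKX A R"
    using domain_A_plus_XKX[OF subfieldE(1)[OF assms]] .
  show ?thesis
    using A_plus_XKX_factorization_exists[OF assms] A_plus_XKX_factors_length[OF assms]
    by unfold_locales metis+
qed

text \<open>If \<open>f\<close> is irreducible with \<open>f(0) = 0\<close>, then \<open>f = a \<cdot> (a\<^sup>-\<^sup>1 f)\<close> is a factorization
  inside \<open>A + XK[X]\<close> for every nonzero \<open>a\<close> in \<open>A\<close>, which forces \<open>a\<close> to be a unit of \<open>A\<close>.\<close>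

lemma atomic_A_plus_XKX_imp_subfield:
  assumes A: "subring A R" and "atomic_domain (A_plus_XKX A R)"
  shows "subfield A R"
proof -
  let ?S = "A_plus_XKX A R"
  interpret UP: domain "poly_ring R"
    using univ_poly_is_domain[OF carrier_is_subring] .
  interpret S: atomic_domain ?S
    by fact
  note const_term = const_term_simprules_shell[OF carrier_is_subring]
  have X: "X \<in> carrier (poly_ring R)" "const_term X = \<zero>" "X \<noteq> \<zero>\<^bsub>poly_ring R\<^esub>"
    using var_closed(1)[OF carrier_is_subring] by (auto simp: var_def const_term_def univ_poly_zero)
  then have "X \<in> carrier ?S" "X \<notin> Units ?S"
    using subringE(2)[OF A] const_term_Units Units_A_plus_XKX_subset
    by (auto simp: carrier_A_plus_XKX)
  then obtain fs where fs: "set fs \<subseteq> carrier ?S" "factors ?S fs X"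
    using S.factorization_exists X by auto
  \<comment> \<open>Constant terms multiply and K has no zero divisors, so a product vanishing at 0
    has a factor vanishing at 0. Stating this for arbitrary \<open>p\<close> lets the induction
    reach the tail of the list.\<close>
  have vanishing_factor: "\<exists>f \<in> set fs. f \<noteq> \<zero>\<^bsub>poly_ring R\<^esub> \<and> const_term f = \<zero>"
    if "set fs \<subseteq> carrier (poly_ring R)" "foldr (\<otimes>\<^bsub>poly_ring R\<^esub>) fs \<one>\<^bsub>poly_ring R\<^esub> = p"
      "p \<noteq> \<zero>\<^bsub>poly_ring R\<^esub>" "const_term p = \<zero>" for p fs
    using that
  proof (induction fs arbitrary: p)
    case Nil
    then show ?case
      by (auto simp: univ_poly_one const_term_def)
  next
    case (Cons f fs)
    let ?q = "foldr (\<otimes>\<^bsub>poly_ring R\<^esub>) fs \<one>\<^bsub>poly_ring R\<^esub>"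
    have q: "f \<in> carrier (poly_ring R)" "?q \<in> carrier (poly_ring R)"
      using Cons.prems(1) by (auto intro: UP.multlist_closed)
    then have "f \<noteq> \<zero>\<^bsub>poly_ring R\<^esub>" "?q \<noteq> \<zero>\<^bsub>poly_ring R\<^esub>"
      using Cons.prems(2,3) by auto
    moreover have "const_term f \<otimes> const_term ?q = \<zero>"
      using Cons.prems(2,4) const_term(2)[OF q] by simp
    then have "const_term f = \<zero> \<or> const_term ?q = \<zero>"
      using integral const_term(1) q by blast
    ultimately show ?case
      using Cons.IH[OF _ refl] Cons.prems(1) by auto
  qed
  have "set fs \<subseteq> carrier (poly_ring R)" "foldr (\<otimes>\<^bsub>poly_ring R\<^esub>) fs \<one>\<^bsub>poly_ring R\<^esub> = X"
    using fs by (auto simp: carrier_A_plus_XKX factors_def)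
  from vanishing_factor[OF this X(3,2)]
  obtain f where f: "f \<in> set fs" "f \<noteq> \<zero>\<^bsub>poly_ring R\<^esub>" "const_term f = \<zero>"
    by blast
  then have irr: "f \<in> carrier ?S" "ring_irreducible\<^bsub>?S\<^esub> f"
    using fs by (auto simp: factors_def ring_irreducible_def)
  then have carr: "f \<in> carrier (poly_ring R)"
    by (simp add: carrier_A_plus_XKX)
  show ?thesis
  proof (rule subfieldI'[OF A])
    fix a assume a: "a \<in> A - {\<zero>}"
    then have a': "a \<in> carrier R" "a \<noteq> \<zero>"
      using subringE(1)[OF A] by auto
    then have inv: "inv a \<in> carrier R" "inv a \<noteq> \<zero>"
      using field_Units by auto
    \<comment> \<open>Since f(0) = 0, this multiple stays in the subring even before
      \<open>inv a\<close> is known to lie in \<open>A\<close>; vanishing at 0, it cannot be a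
      unit.\<close>
    let ?h = "[inv a] \<otimes>\<^bsub>poly_ring R\<^esub> f"
    have h: "const_term ?h = \<zero>" "?h \<in> carrier (poly_ring R)"
      using const_term(2) const_poly[OF inv] inv carr f(3) by auto
    have "[a] \<in> carrier ?S" "?h \<in> carrier ?S"
      using a h const_poly[OF a'] subringE(2)[OF A] by (auto simp: carrier_A_plus_XKX)
    moreover have "f = [a] \<otimes>\<^bsub>poly_ring R\<^esub> ?h"
      using carr mult_const_poly_inv[OF a'] UP.m_assoc[of "[a]" "[inv a]" f]
        const_poly(1)[OF a'] const_poly(1)[OF inv] by simp
    moreover have "?h \<notin> Units ?S"
      using h const_term_Units Units_A_plus_XKX_subset by auto
    ultimately have "[a] \<in> Units ?S"
      using S.ring_irreducibleE(5)[OF irr] unfolding A_plus_XKX_ops by blast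
    then obtain b where b: "b \<in> carrier ?S" "b \<otimes>\<^bsub>poly_ring R\<^esub> [a] = \<one>\<^bsub>poly_ring R\<^esub>"
      unfolding Units_def by auto
    \<comment> \<open>Comparing constant terms identifies \<open>inv a\<close> with b(0), which lies
      in \<open>A\<close>.\<close>
    then have "const_term b \<otimes> a = \<one>"
      using const_term(2)[of b "[a]"] const_poly[OF a']
      by (simp add: carrier_A_plus_XKX) (simp add: univ_poly_one const_term_def)
    then have "inv a = const_term b"
      using a' b const_term(1) by (intro comm_inv_char) (auto simp: carrier_A_plus_XKX m_comm)
    then show "inv a \<in> A"
      using b by (simp add: carrier_A_plus_XKX)
  qed
qed

end

theorem proposition2p5:
  fixes K :: "('a, 'b) ring_scheme" and A :: "'a set"
  assumes "field K" and "subring A K"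
  shows "half_factorial_domain (A_plus_XKX A K) \<longleftrightarrow> field (K \<lparr> carrier := A \<rparr>)"
proof -
  interpret field K
    by fact
  have "field (K \<lparr> carrier := A \<rparr>) \<longleftrightarrow> subfield A K"
    using subfield_iff subringE(1)[OF assms(2)] by blast
  then show ?thesis
    using subfield_imp_half_factorial_A_plus_XKX half_factorial_domain.axioms(1)
      atomic_A_plus_XKX_imp_subfield[OF assms(2)] by blast
qed

end
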